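(* Let $(S,\mathcal{S})$ be a measurable space and let $P=(P(x,dy):x,y\in S)$ be the one-step transition kernel of a Markov chain $X$ on $S$. Let $(A_n:n\ge1)$ be a sequence of measurable subsets of $S$ with $\emptyset\ne A_1\subseteq A_2\subseteq\cdots$ and $\bigcup_{n=1}^\infty A_n=S$. Suppose that $X$ is strongly uniformly recurrent under $P$, i.e. there exist $\lambda>0$ and a probability $\phi$ on $S$ with $P(x,B)\ge\lambda\phi(B)$ for all $x\in S$ and all measurable $B\subseteq S$, where $\phi$ is supported on $A_1$ (that is, $\phi(A_1)=1$), and that $X$ has a unique stationary distribution $\pi$ under $P$. For each $n\ge1$, let $P_n$ be an arbitrary general augmentation of $P$ on $A_n$. Then, for each $n\geq 1$, $X$ is strongly uniformly recurrent under $P_n$ (as a chain on $A_n$) with a unique stationary distribution $\pi_n$, and $$\sup_{A}|\pi_n(A)-\pi(A)|\to0\qquad\text{as }n\to\infty,$$ where the supremum is over all measurable $A\subseteq S$.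
   Context: A Markov chain with transition kernel $P$ on a state space $S$ is strongly uniformly recurrent if there exist $\lambda>0$ and a probability $\phi$ on $S$ such that $P(x,dy)\ge\lambda\phi(dy)$ for all $x,y\in S$ (i.e. $P(x,B)\ge\lambda\phi(B)$ for all $x\in S$ and measurable $B\subseteq S$). The same definition applies to a kernel $P_n$ on $A_n$, with $S$ replaced by $A_n$. A general augmentation of $P$ on $A_n$ is a stochastic kernel $P_n$ on $A_n$ of the form $P_n(x,dy)=P(x,dy)+\tilde R_n(x,dy)$ for $x,y\in A_n$, where $\tilde R_n$ is a non-negative kernel on $A_n$; that is, $P_n(x,B)\ge P(x,B)$ for all $x\in A_n$ and measurable $B\subseteq A_n$. The stationary distribution $\pi_n$ of $P_n$ on $A_n$ is regarded as a probability on $S$ that assigns mass $0$ to $A_n^c$. *)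

theory Defs
  imports "HOL-Probability.Probability"
begin

text \<open>
  Only the \<sigma>-algebra of the parameter \<open>M\<close> matters below: \<open>M\<close> plays the role of the measurable space
  \<open>(S, \<S>)\<close>, and a chain living on a measurable \<open>A \<subseteq> S\<close> is a chain on \<open>restrict_space M A\<close>.
\<close>

definition markov_kernel :: "'a measure \<Rightarrow> ('a \<Rightarrow> 'a measure) \<Rightarrow> bool" where
  "markov_kernel M P \<longleftrightarrow> P \<in> measurable M (prob_algebra M)"

definition minorized :: "'a measure \<Rightarrow> ('a \<Rightarrow> 'a measure) \<Rightarrow> real \<Rightarrow> 'a measure \<Rightarrow> bool" where
  "minorized M P l \<phi> \<longleftrightarrow> (\<forall>x\<in>space M. \<forall>B\<in>sets M. measure (P x) B \<ge> l * measure \<phi> B)"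

definition strongly_uniformly_recurrent :: "'a measure \<Rightarrow> ('a \<Rightarrow> 'a measure) \<Rightarrow> bool" where
  "strongly_uniformly_recurrent M P \<longleftrightarrow>
     (\<exists>l>0. \<exists>\<phi>. prob_space \<phi> \<and> sets \<phi> = sets M \<and> minorized M P l \<phi>)"

definition stationary_distribution :: "'a measure \<Rightarrow> ('a \<Rightarrow> 'a measure) \<Rightarrow> 'a measure \<Rightarrow> bool" where
  "stationary_distribution M P \<pi> \<longleftrightarrow> prob_space \<pi> \<and> sets \<pi> = sets M \<and>
     (\<forall>B\<in>sets M. emeasure \<pi> B = (\<integral>\<^sup>+x. emeasure (P x) B \<partial>\<pi>))"

text \<open>
  Taking the added kernel \<open>R\<close> sub-stochastic is no restriction: its total mass at \<open>x\<close> is at most that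
  of \<open>P' x\<close>, which is 1 (see \<open>general_augmentation_iff\<close>).
\<close>

definition general_augmentation ::
  "'a measure \<Rightarrow> 'a set \<Rightarrow> ('a \<Rightarrow> 'a measure) \<Rightarrow> ('a \<Rightarrow> 'a measure) \<Rightarrow> bool" where
  "general_augmentation M A P P' \<longleftrightarrow> markov_kernel (restrict_space M A) P' \<and>
     (\<exists>R \<in> measurable (restrict_space M A) (subprob_algebra (restrict_space M A)).
        \<forall>x\<in>A. \<forall>B\<in>sets (restrict_space M A).
          emeasure (P' x) B = emeasure (P x) B + emeasure (R x) B)"

lemma general_augmentation_iff:
  assumes P: "markov_kernel M P" and A: "A \<in> sets M"
  shows "general_augmentation M A P P' \<longleftrightarrow> markov_kernel (restrict_space M A) P' \<and>
    (\<forall>x\<in>A. \<forall>B\<in>sets M. B \<subseteq> A \<longrightarrow> measure (P' x) B \<ge> measure (P x) B)"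
    (is "?L \<longleftrightarrow> ?K \<and> ?D")
proof -
  let ?N = "restrict_space M A"
  have spN: "space ?N = A"
    using A sets.sets_into_space by (auto simp: space_restrict_space)
  have stN: "B \<in> sets ?N \<longleftrightarrow> B \<in> sets M \<and> B \<subseteq> A" for B
    using A by (auto simp: sets_restrict_space_iff)
  have Px: "prob_space (P x)" "sets (P x) = sets M" if "x \<in> A" for x
    using measurable_space[OF P[unfolded markov_kernel_def], of x] that A sets.sets_into_space
    by (auto simp: space_prob_algebra)
  have P'x: "prob_space (P' x)" "sets (P' x) = sets ?N" if ?K "x \<in> A" for x
    using measurable_space[OF that(1)[unfolded markov_kernel_def], of x] that spN
    by (auto simp: space_prob_algebra)
  have fin: "emeasure (P x) B = ennreal (measure (P x) B)"
            "emeasure (P' x) B = ennreal (measure (P' x) B)" if ?K "x \<in> A" for x B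
    using finite_measure.emeasure_eq_measure[OF prob_space.finite_measure[OF Px(1)[OF that(2)]]]
      finite_measure.emeasure_eq_measure[OF prob_space.finite_measure[OF P'x(1)[OF that]]]
    by auto
  show ?thesis
  proof
    assume L: ?L
    then have K: ?K by (simp add: general_augmentation_def)
    have ?D
    proof (intro ballI impI)
      fix x B assume x: "x \<in> A" and B: "B \<in> sets M" "B \<subseteq> A"
      have "emeasure (P x) B \<le> emeasure (P' x) B"
        using L x B stN unfolding general_augmentation_def by fastforce
      then show "measure (P x) B \<le> measure (P' x) B"
        by (simp add: fin[OF K x])
    qed
    with K show "?K \<and> ?D" by simp
  next
    assume "?K \<and> ?D"
    then have K: ?K and D: ?D by auto
    define R where "R x = diff_measure (P' x) (restrict_space (P x) A)" for x
    have sres: "sets (restrict_space (P x) A) = sets ?N" if "x \<in> A" for x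
      using Px(2)[OF that] by (simp add: sets_restrict_space)
    have eres: "emeasure (restrict_space (P x) A) B = emeasure (P x) B"
      if "x \<in> A" "B \<subseteq> A" for x B
      using that A Px(2)[OF that(1)]
      by (intro emeasure_restrict_space) (auto simp: sets.Int_space_eq2)
    have le: "emeasure (P x) B \<le> emeasure (P' x) B" if "x \<in> A" "B \<in> sets ?N" for x B
      using D that stN by (auto simp: fin[OF K that(1)] intro!: ennreal_leI)
    have finres: "finite_measure (restrict_space (P x) A)" if x: "x \<in> A" for x
      using A Px(2)[OF x] prob_space.finite_measure[OF Px(1)[OF x]]
      by (intro finite_measure_restrict_space) auto
    have eR: "emeasure (R x) B = emeasure (P' x) B - emeasure (P x) B"
      if x: "x \<in> A" and B: "B \<in> sets ?N" for x B
      unfolding R_def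
      using B stN le[OF x] P'x[OF K x] sres[OF x] finres[OF x]
      by (subst emeasure_diff_measure) (auto simp: eres[OF x] prob_space.finite_measure)
    have sR: "sets (R x) = sets ?N" if "x \<in> A" for x
      using P'x[OF K that] by (simp add: R_def)
    have Rm: "R \<in> measurable ?N (subprob_algebra ?N)"
    proof (rule measurable_subprob_algebra)
      fix x assume "x \<in> space ?N"
      then have x: "x \<in> A" using spN by simp
      show "sets (R x) = sets ?N" by (rule sR[OF x])
      have spR: "space (R x) = A" using sets_eq_imp_space_eq[OF sR[OF x]] spN by simp
      have AN: "A \<in> sets ?N" using A stN by simp
      have "emeasure (R x) A \<le> emeasure (P' x) A"
        unfolding eR[OF x AN] by (simp add: fin[OF K x] ennreal_minus)
      also have "\<dots> \<le> 1" by (rule prob_space.emeasure_le_1[OF P'x(1)[OF K x]])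
      finally show "subprob_space (R x)" using spR x by (intro subprob_spaceI) auto
    next
      fix B assume B: "B \<in> sets ?N"
      have PN: "P \<in> measurable ?N (subprob_algebra M)"
        using P unfolding markov_kernel_def
        by (intro measurable_restrict_space1 measurable_prob_algebraD)
      have P'N: "P' \<in> measurable ?N (subprob_algebra ?N)"
        using K unfolding markov_kernel_def by (rule measurable_prob_algebraD)
      have "(\<lambda>x. emeasure (P' x) B - emeasure (P x) B) \<in> borel_measurable ?N"
        using B stN
        by (intro borel_measurable_minus_ennreal measurable_emeasure_kernel[OF PN]
              measurable_emeasure_kernel[OF P'N]) auto
      then show "(\<lambda>x. emeasure (R x) B) \<in> borel_measurable ?N"
        using B by (subst measurable_cong[OF eR]) (auto simp: spN)
    qed
    moreover have "emeasure (P' x) B = emeasure (P x) B + emeasure (R x) B"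
      if "x \<in> A" "B \<in> sets ?N" for x B
      using le[OF that] by (simp add: eR[OF that] add_diff_inverse_ennreal)
    ultimately show ?L using K unfolding general_augmentation_def by blast
  qed
qed

text \<open>A measure on \<open>A\<close> seen as a measure on the whole space: its image under the inclusion map.\<close>

definition extend_measure_to :: "'a measure \<Rightarrow> 'a measure \<Rightarrow> 'a measure" where
  "extend_measure_to M \<nu> = distr \<nu> M (\<lambda>x. x)"

lemma measure_extend_measure_to:
  assumes "A \<in> sets M" and "sets \<nu> = sets (restrict_space M A)" and "B \<in> sets M"
  shows "measure (extend_measure_to M \<nu>) B = measure \<nu> (B \<inter> A)"
proof -
  have sp: "space \<nu> = A"
    using sets_eq_imp_space_eq[OF assms(2)] assms(1) sets.sets_into_space
    by (auto simp: space_restrict_space)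
  have "(\<lambda>x. x) \<in> measurable (restrict_space M A) M"
    by (intro measurable_restrict_space1) simp
  then have "(\<lambda>x. x) \<in> measurable \<nu> M"
    using measurable_cong_sets[OF assms(2) refl] by blast
  then show ?thesis
    using assms(3) sp by (simp add: extend_measure_to_def measure_distr)
qed

end

theory Submission imports Defs
begin

text \<open>
  Replacing \<open>l\<close> by a smaller constant below 1, write \<open>P = l \<phi> + (1 - l) Q\<close> with a stochastic residual kernel \<open>Q\<close>, and let \<open>T\<^sub>n\<close>
  be the sub-stochastic kernel \<open>(1 - l) Q\<close> killed outside \<open>A\<^sub>n\<close>. Augmenting only adds mass, so
  \<open>\<pi>\<^sub>n \<ge> l \<phi> + \<pi>\<^sub>n T\<^sub>n\<close> and, by iteration, \<open>\<pi>\<^sub>n \<ge> \<mu>\<^sub>n := l (\<Sum>k<K. \<phi> T\<^sub>n^k)\<close>; for the same reason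
  \<open>\<pi> \<ge> \<mu>\<^sub>n\<close>. Two probabilities above a common measure \<open>\<mu>\<^sub>n\<close> differ by at most \<open>1 - \<mu>\<^sub>n(S)\<close> in total
  variation. As \<open>A\<^sub>n\<close> exhausts \<open>S\<close>, \<open>\<mu>\<^sub>n(S)\<close> tends to \<open>1 - (1 - l)^K\<close> by dominated convergence,
  and \<open>K\<close> is arbitrary. With no killing the same bound gives uniqueness of the stationary
  distribution.
\<close>

section \<open>Integrals under mixtures and stationary laws\<close>

text \<open>Both sides are linear in \<open>f\<close> and continuous along increasing sequences, so
  agreement on indicators suffices. It serves twice: for the splitting of \<open>P\<close> into
  \<open>\<phi>\<close> and \<open>Q\<close>, and with \<open>a = b = 1\<close> for the sum of
  \<open>P\<close> and the added kernel.\<close>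

lemma nn_integral_mixture:
  assumes sets: "sets M1 = sets M" "sets M2 = sets M" "sets M3 = sets M"
    and em: "\<And>B. B \<in> sets M \<Longrightarrow> emeasure M1 B = a * emeasure M2 B + b * emeasure M3 B"
    and f: "f \<in> borel_measurable M"
  shows "(\<integral>\<^sup>+x. f x \<partial>M1) = a * (\<integral>\<^sup>+x. f x \<partial>M2) + b * (\<integral>\<^sup>+x. f x \<partial>M3)"
proof -
  note [measurable_cong] = sets
  have sp: "space M1 = space M" "space M2 = space M" "space M3 = space M"
    using sets by (auto dest: sets_eq_imp_space_eq)
  show ?thesis
    using f
  proof induction
    case (cong f g)
    then show ?case
      using nn_integral_cong[of M1 f g] nn_integral_cong[of M2 f g] nn_integral_cong[of M3 f g]
      by (simp add: sp)
  next
    case (set A)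
    then show ?case using sets by (simp add: em)
  next
    case (mult u c)
    note [measurable] = mult(2)
    show ?case
      by (simp add: nn_integral_cmult mult distrib_left ac_simps)
  next
    case (add u v)
    note [measurable] = add(1,3)
    show ?case by (simp add: nn_integral_add add distrib_left ac_simps)
  next
    case (seq U)
    note [measurable] = seq(1)
    have inc: "incseq (\<lambda>i. \<integral>\<^sup>+x. U i x \<partial>N)" for N
      using \<open>incseq U\<close> by (auto simp: incseq_def le_fun_def intro!: nn_integral_mono)
    have "(\<integral>\<^sup>+x. (SUP i. U i x) \<partial>N) = (SUP i. \<integral>\<^sup>+x. U i x \<partial>N)" if [measurable_cong]: "sets N = sets M" for N
      using \<open>incseq U\<close> by (intro nn_integral_monotone_convergence_SUP) auto
    note * = this[OF sets(1)] this[OF sets(2)] this[OF sets(3)]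
    have "(\<integral>\<^sup>+x. (SUP i. U i x) \<partial>M1) = (SUP i. a * (\<integral>\<^sup>+x. U i x \<partial>M2) + b * (\<integral>\<^sup>+x. U i x \<partial>M3))"
      by (simp add: * seq)
    also have "\<dots> = (SUP i. a * (\<integral>\<^sup>+x. U i x \<partial>M2)) + (SUP i. b * (\<integral>\<^sup>+x. U i x \<partial>M3))"
      using inc by (intro ennreal_SUP_add) (auto simp: incseq_def mult_left_mono)
    finally show ?case
      by (simp add: * SUP_mult_left_ennreal image_comp)
  qed
qed

text \<open>Stationarity is the fixed point equation \<open>\<pi> = \<pi> \<bind> P\<close>, and
  integrals against a bind are iterated integrals.\<close>

lemma stationary_nn_integral:
  assumes st: "stationary_distribution M P \<pi>" and P: "P \<in> measurable M (prob_algebra M)"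
    and f: "f \<in> borel_measurable M"
  shows "(\<integral>\<^sup>+x. f x \<partial>\<pi>) = (\<integral>\<^sup>+x. \<integral>\<^sup>+y. f y \<partial>P x \<partial>\<pi>)"
proof -
  have p: "prob_space \<pi>" and s[measurable_cong]: "sets \<pi> = sets M"
    using st by (auto simp: stationary_distribution_def)
  have ne: "space \<pi> \<noteq> {}" using p by (rule prob_space.not_empty)
  have P': "P \<in> measurable \<pi> (subprob_algebra M)"
    using measurable_prob_algebraD[OF P] by measurable
  have "\<pi> = \<pi> \<bind> P"
  proof (rule measure_eqI)
    show "sets \<pi> = sets (\<pi> \<bind> P)"
      using ne P' by (simp add: s sets_kernel[OF P'])
    show "emeasure \<pi> B = emeasure (\<pi> \<bind> P) B" if "B \<in> sets \<pi>" for B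
      using st that s by (simp add: emeasure_bind[OF ne P'] stationary_distribution_def)
  qed
  then have "(\<integral>\<^sup>+x. f x \<partial>\<pi>) = (\<integral>\<^sup>+x. f x \<partial>(\<pi> \<bind> P))" by simp
  also have "\<dots> = (\<integral>\<^sup>+x. \<integral>\<^sup>+y. f y \<partial>P x \<partial>\<pi>)"
    by (rule nn_integral_bind[OF f P'])
  finally show ?thesis .
qed

section \<open>Splitting of a minorized kernel\<close>

text \<open>Take \<open>Q = (P - l \<phi>) / (1 - l)\<close>: the minorization makes the difference
  non-negative, its total mass is \<open>1 - l\<close>, and \<open>l < 1\<close> allows the
  normalisation.\<close>

lemma residual_kernel:
  assumes P: "P \<in> measurable M (prob_algebra M)"
    and \<phi>: "prob_space \<phi>" "sets \<phi> = sets M" and l: "0 < l" "l < 1"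
    and minor: "minorized M P l \<phi>"
  obtains Q where "Q \<in> measurable M (prob_algebra M)"
    and "\<And>x B. x \<in> space M \<Longrightarrow> B \<in> sets M \<Longrightarrow>
      emeasure (P x) B = ennreal l * emeasure \<phi> B + ennreal (1 - l) * emeasure (Q x) B"
proof
  have Px: "prob_space (P x)" "sets (P x) = sets M" if "x \<in> space M" for x
    using measurable_space[OF P that] by (auto simp: space_prob_algebra)
  define D where "D x = diff_measure (P x) (scale_measure (ennreal l) \<phi>)" for x
  define Q where "Q x = scale_measure (ennreal (1 / (1 - l))) (D x)" for x
  interpret phi: prob_space \<phi> by fact
  have em\<phi>: "ennreal l * emeasure \<phi> B = ennreal (l * measure \<phi> B)" for B
    using l by (simp add: phi.emeasure_eq_measure ennreal_mult')
  have le: "l * measure \<phi> B \<le> measure (P x) B" if "x \<in> space M" "B \<in> sets M" for x B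
    using minor that by (simp add: minorized_def)
  have emP: "emeasure (P x) B = ennreal (measure (P x) B)" if "x \<in> space M" for x B
    using Px(1)[OF that] by (simp add: finite_measure.emeasure_eq_measure prob_space.finite_measure)
  have eD: "emeasure (D x) B = emeasure (P x) B - ennreal l * emeasure \<phi> B"
    if x: "x \<in> space M" and B: "B \<in> sets M" for x B
  proof -
    have "finite_measure (scale_measure (ennreal l) \<phi>)"
      by (rule finite_measureI) (simp add: space_scale_measure phi.emeasure_space_1)
    then show ?thesis
      unfolding D_def using B \<phi> Px[OF x] le[OF x]
      by (subst emeasure_diff_measure)
        (auto simp: prob_space.finite_measure em\<phi> emP[OF x] intro!: ennreal_leI)
  qed
  have sD: "sets (Q x) = sets M" if "x \<in> space M" for x
    using Px[OF that] by (simp add: D_def Q_def)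
  have eQ: "emeasure (Q x) B = ennreal (1 / (1 - l)) * (emeasure (P x) B - ennreal l * emeasure \<phi> B)"
    if "x \<in> space M" "B \<in> sets M" for x B
    using eD[OF that] by (simp add: Q_def)
  show pQ: "Q \<in> measurable M (prob_algebra M)"
  proof (rule measurable_prob_algebraI)
    show prob: "prob_space (Q x)" if x: "x \<in> space M" for x
    proof
      have "space (Q x) = space M" using sD[OF x] by (rule sets_eq_imp_space_eq)
      moreover have "measure (P x) (space M) = 1" "measure \<phi> (space M) = 1"
        using prob_space.prob_space[OF Px(1)[OF x]] phi.prob_space
          sets_eq_imp_space_eq[OF Px(2)[OF x]] sets_eq_imp_space_eq[OF \<phi>(2)] by auto
      ultimately show "emeasure (Q x) (space (Q x)) = 1"
        using l by (simp add: eQ[OF x] em\<phi> emP[OF x] ennreal_minus flip: ennreal_mult'' ennreal_1)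
    qed
    have PM: "P \<in> measurable M (subprob_algebra M)"
      by (rule measurable_prob_algebraD[OF P])
    show "Q \<in> measurable M (subprob_algebra M)"
    proof (rule measurable_subprob_algebra)
      fix B assume B: "B \<in> sets M"
      have [measurable]: "(\<lambda>x. emeasure (P x) B) \<in> borel_measurable M"
        by (rule measurable_emeasure_kernel[OF PM B])
      show "(\<lambda>x. emeasure (Q x) B) \<in> borel_measurable M"
        by (subst measurable_cong[OF eQ[OF _ B]]) auto
    qed (auto simp: sD prob prob_space_imp_subprob_space)
  qed
  show "emeasure (P x) B = ennreal l * emeasure \<phi> B + ennreal (1 - l) * emeasure (Q x) B"
    if x: "x \<in> space M" and B: "B \<in> sets M" for x B
    using l le[OF x B]
    by (simp add: eQ[OF x B] em\<phi> emP[OF x] ennreal_minus flip: ennreal_mult'' ennreal_plus)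
qed

section \<open>The killed residual kernel and its powers\<close>

text \<open>The kernel \<open>P\<close> is not fixed here; the lemmas that need it assume the
  splitting of \<open>P x\<close> explicitly.\<close>

locale split_chain =
  fixes M :: "'a measure" and l :: real and \<phi> :: "'a measure" and Q :: "'a \<Rightarrow> 'a measure"
  assumes l: "0 < l" "l < 1"
    and prob_\<phi>: "prob_space \<phi>" and sets_\<phi>: "sets \<phi> = sets M"
    and Q: "Q \<in> measurable M (prob_algebra M)"
begin

text \<open>The sub-stochastic kernel is encoded by its action on functions, so that its powers are
  plain \<open>funpow\<close> iterates and no powers of kernels have to be formed.\<close>

definition killed :: "'a set \<Rightarrow> ('a \<Rightarrow> ennreal) \<Rightarrow> 'a \<Rightarrow> ennreal" where
  "killed A f x = ennreal (1 - l) * (\<integral>\<^sup>+y. f y * indicator A y \<partial>Q x)"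

text \<open>This is the inequality \<open>\<nu> \<ge> l \<phi> + \<nu> T\<close> between measures,
  with \<open>T\<close> the killed kernel. It is tested on functions instead of sets because the
  iteration applies it to \<open>killed A f\<close>.\<close>

definition dominates :: "'a set \<Rightarrow> 'a measure \<Rightarrow> bool" where
  "dominates A \<nu> \<longleftrightarrow> (\<forall>f\<in>borel_measurable M.
     ennreal l * (\<integral>\<^sup>+x. f x \<partial>\<phi>) + (\<integral>\<^sup>+x. killed A f x \<partial>\<nu>) \<le> (\<integral>\<^sup>+x. f x \<partial>\<nu>))"

text \<open>The integral of \<open>f\<close> against the common lower bound, the first
  \<open>K\<close> terms of the series of the measures \<open>l \<phi> T^k\<close>.\<close>

definition partial_potential :: "'a set \<Rightarrow> nat \<Rightarrow> ('a \<Rightarrow> ennreal) \<Rightarrow> ennreal" where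
  "partial_potential A K f = (\<Sum>k<K. ennreal l * (\<integral>\<^sup>+x. (killed A ^^ k) f x \<partial>\<phi>))"

lemma Q_subprob: "Q \<in> measurable M (subprob_algebra M)"
  by (rule measurable_prob_algebraD[OF Q])

lemma Qx: "x \<in> space M \<Longrightarrow> prob_space (Q x)" "x \<in> space M \<Longrightarrow> sets (Q x) = sets M"
  "x \<in> space M \<Longrightarrow> space (Q x) = space M"
  using measurable_space[OF Q, of x] by (auto simp: space_prob_algebra dest: sets_eq_imp_space_eq)

lemma killed_measurable:
  assumes A: "A \<in> sets M" and f: "f \<in> borel_measurable M"
  shows "killed A f \<in> borel_measurable M"
proof -
  note [measurable] = A f Q_subprob
  have "(\<lambda>x. \<integral>\<^sup>+y. f y * indicator A y \<partial>Q x) \<in> borel_measurable M"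
    by (rule nn_integral_measurable_subprob_algebra2[OF _ Q_subprob]) measurable
  then show ?thesis unfolding killed_def by measurable
qed

lemma killed_funpow_Suc:
  "(killed A ^^ Suc k) f x = ennreal (1 - l) * (\<integral>\<^sup>+y. (killed A ^^ k) f y * indicator A y \<partial>Q x)"
  unfolding funpow.simps o_apply by (rule killed_def)

lemma killed_funpow_measurable:
  assumes "A \<in> sets M" "f \<in> borel_measurable M"
  shows "(killed A ^^ k) f \<in> borel_measurable M"
  by (induction k) (auto intro!: killed_measurable assms)

text \<open>Linearity of the integral, inherited by powers. It is restricted to points of the space,
  since nothing is known about \<open>Q x\<close> elsewhere.\<close>

lemma killed_funpow_add:
  assumes A: "A \<in> sets M" and f: "f \<in> borel_measurable M" and g: "g \<in> borel_measurable M"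
    and x: "x \<in> space M"
  shows "(killed A ^^ k) (\<lambda>x. f x + g x) x = (killed A ^^ k) f x + (killed A ^^ k) g x"
  using x
proof (induction k arbitrary: x)
  case (Suc k)
  note [measurable] = A killed_funpow_measurable[OF A f] killed_funpow_measurable[OF A g]
  note [measurable_cong] = Qx(2)[OF Suc.prems]
  have "(\<integral>\<^sup>+y. (killed A ^^ k) (\<lambda>x. f x + g x) y * indicator A y \<partial>Q x) =
      (\<integral>\<^sup>+y. (killed A ^^ k) f y * indicator A y + (killed A ^^ k) g y * indicator A y \<partial>Q x)"
    by (intro nn_integral_cong) (simp add: Suc Qx distrib_right)
  also have "\<dots> = (\<integral>\<^sup>+y. (killed A ^^ k) f y * indicator A y \<partial>Q x)
      + (\<integral>\<^sup>+y. (killed A ^^ k) g y * indicator A y \<partial>Q x)"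
    by (intro nn_integral_add) measurable
  finally show ?case unfolding killed_funpow_Suc by (simp add: distrib_left)
qed simp

lemma killed_funpow_one_le:
  assumes x: "x \<in> space M"
  shows "(killed A ^^ k) (\<lambda>_. 1) x \<le> 1"
  using x
proof (induction k arbitrary: x)
  case (Suc k)
  interpret prob_space "Q x" using Qx(1)[OF Suc.prems] .
  have "(\<integral>\<^sup>+y. (killed A ^^ k) (\<lambda>_. 1) y * indicator A y \<partial>Q x) \<le> (\<integral>\<^sup>+y. 1 \<partial>Q x)"
    using Suc by (intro nn_integral_mono) (auto simp: Qx indicator_def)
  also have "\<dots> = 1" by (simp add: emeasure_space_1)
  finally have "ennreal (1 - l) * (\<integral>\<^sup>+y. (killed A ^^ k) (\<lambda>_. 1) y * indicator A y \<partial>Q x) \<le> 1 * 1"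
    using l by (intro mult_mono) auto
  then show ?case unfolding killed_funpow_Suc by simp
qed simp

text \<open>With no killing, each step multiplies the constant function by \<open>1 - l\<close>
  because \<open>Q\<close> is stochastic. Induction on \<open>k\<close> carries the limit through
  the integral by dominated convergence with bound 1; each point need only lie in \<open>A n\<close>
  for all large \<open>n\<close>.\<close>

lemma killed_funpow_one_tendsto:
  assumes A: "\<And>n. A n \<in> sets M" and ex: "\<And>x. x \<in> space M \<Longrightarrow> \<forall>\<^sub>F n in sequentially. x \<in> A n"
    and x: "x \<in> space M"
  shows "(\<lambda>n. (killed (A n) ^^ k) (\<lambda>_. 1) x) \<longlonglongrightarrow> ennreal ((1 - l) ^ k)"
  using x
proof (induction k arbitrary: x)
  case (Suc k)
  interpret prob_space "Q x" using Qx(1)[OF Suc.prems] .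
  note [measurable_cong] = Qx(2)[OF Suc.prems]
  note [measurable] = A killed_funpow_measurable[OF A]
  have "(\<lambda>n. \<integral>\<^sup>+y. (killed (A n) ^^ k) (\<lambda>_. 1) y * indicator (A n) y \<partial>Q x)
      \<longlonglongrightarrow> (\<integral>\<^sup>+y. ennreal ((1 - l) ^ k) \<partial>Q x)"
  proof (rule nn_integral_dominated_convergence[where w="\<lambda>_. 1"])
    show "AE y in Q x. (\<lambda>n. (killed (A n) ^^ k) (\<lambda>_. 1) y * indicator (A n) y) \<longlonglongrightarrow> ennreal ((1 - l) ^ k)"
    proof (rule AE_I2)
      fix y assume "y \<in> space (Q x)"
      then have y: "y \<in> space M" using Qx(3) Suc.prems by simp
      show "(\<lambda>n. (killed (A n) ^^ k) (\<lambda>_. 1) y * indicator (A n) y) \<longlonglongrightarrow> ennreal ((1 - l) ^ k)"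
        \<comment> \<open>The indicator is 1 for all large \<open>n\<close>, so the product has the
          limit given by the induction hypothesis.\<close>
        by (rule Lim_transform_eventually[OF Suc.IH[OF y]])
          (use ex[OF y] in eventually_elim, simp)
    qed
    show "AE y in Q x. (killed (A n) ^^ k) (\<lambda>_. 1) y * indicator (A n) y \<le> 1" for n
      using killed_funpow_one_le Qx(3)[OF Suc.prems]
      by (intro AE_I2) (auto simp: indicator_def)
  qed (auto simp: emeasure_space_1)
  then have "(\<lambda>n. ennreal (1 - l) * (\<integral>\<^sup>+y. (killed (A n) ^^ k) (\<lambda>_. 1) y * indicator (A n) y \<partial>Q x))
      \<longlonglongrightarrow> ennreal (1 - l) * ennreal ((1 - l) ^ k)"
    by (intro ennreal_tendsto_cmult) (auto simp: emeasure_space_1)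
  then show ?case using l unfolding killed_funpow_Suc by (simp add: ennreal_mult')
qed simp

lemma partial_potential_one_tendsto:
  assumes A: "\<And>n. A n \<in> sets M" and ex: "\<And>x. x \<in> space M \<Longrightarrow> \<forall>\<^sub>F n in sequentially. x \<in> A n"
  shows "(\<lambda>n. partial_potential (A n) K (\<lambda>_. 1)) \<longlonglongrightarrow> ennreal (1 - (1 - l) ^ K)"
proof -
  interpret prob_space \<phi> by (rule prob_\<phi>)
  note [measurable_cong] = sets_\<phi>
  note [measurable] = A killed_funpow_measurable[OF A]
  have sp: "space \<phi> = space M" using sets_\<phi> by (rule sets_eq_imp_space_eq)
  have [simp]: "emeasure \<phi> (space M) = 1" using emeasure_space_1 by (simp add: sp)
  have "(\<lambda>n. \<integral>\<^sup>+x. (killed (A n) ^^ k) (\<lambda>_. 1) x \<partial>\<phi>) \<longlonglongrightarrow> (\<integral>\<^sup>+x. ennreal ((1 - l) ^ k) \<partial>\<phi>)" for k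
    using killed_funpow_one_tendsto[OF A ex] killed_funpow_one_le sp
    by (intro nn_integral_dominated_convergence[where w="\<lambda>_. 1"]) (auto simp: emeasure_space_1)
  then have "(\<lambda>n. partial_potential (A n) K (\<lambda>_. 1)) \<longlonglongrightarrow> (\<Sum>k<K. ennreal l * ennreal ((1 - l) ^ k))"
    unfolding partial_potential_def
    by (intro tendsto_sum ennreal_tendsto_cmult) (auto simp: emeasure_space_1)
  also have "(\<Sum>k<K. ennreal l * ennreal ((1 - l) ^ k)) = ennreal (l * (\<Sum>k<K. (1 - l) ^ k))"
    using l by (simp add: sum_distrib_left flip: ennreal_mult'')
  \<comment> \<open>A finite geometric sum with ratio \<open>1 - l\<close>, whose complement to 1 is
    \<open>l\<close>.\<close>
  also have "l * (\<Sum>k<K. (1 - l) ^ k) = 1 - (1 - l) ^ K"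
    using one_diff_power_eq[of "1 - l" K] by simp
  finally show ?thesis .
qed

section \<open>Domination and the total variation bound\<close>

text \<open>Iterating the domination inequality adds one term of the series at each step. The
  induction on \<open>K\<close> keeps \<open>f\<close> arbitrary, as its hypothesis is used for
  \<open>killed A f\<close>.\<close>

lemma dominates_partial_potential:
  assumes dom: "dominates A \<nu>" and A: "A \<in> sets M" and f: "f \<in> borel_measurable M"
  shows "partial_potential A K f \<le> (\<integral>\<^sup>+x. f x \<partial>\<nu>)"
  using f
proof (induction K arbitrary: f)
  case (Suc K)
  \<comment> \<open>Split off the term \<open>k = 0\<close>; in each later term one application of
    \<open>killed A\<close> is moved onto \<open>f\<close>.\<close>
  have "partial_potential A (Suc K) f = ennreal l * (\<integral>\<^sup>+x. f x \<partial>\<phi>) + partial_potential A K (killed A f)"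
    unfolding partial_potential_def
    by (subst sum.lessThan_Suc_shift) (simp add: funpow_Suc_right del: funpow.simps)
  also have "\<dots> \<le> ennreal l * (\<integral>\<^sup>+x. f x \<partial>\<phi>) + (\<integral>\<^sup>+x. killed A f x \<partial>\<nu>)"
    by (intro add_left_mono Suc.IH killed_measurable A Suc.prems)
  also have "\<dots> \<le> (\<integral>\<^sup>+x. f x \<partial>\<nu>)"
    using dom Suc.prems by (simp add: dominates_def)
  finally show ?case .
qed (simp add: partial_potential_def)

text \<open>Let \<open>\<mu>\<close> be the common lower bound and \<open>C\<close> the complement
  of \<open>B\<close>. Both probabilities of \<open>B\<close> lie between \<open>\<mu> B\<close> and
  \<open>1 - \<mu> C\<close>, an interval of length one minus the total mass of
  \<open>\<mu>\<close>, which is at most \<open>e\<close>.\<close>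

lemma dominates_close:
  assumes dom: "dominates A \<nu>" "dominates A \<rho>" and A: "A \<in> sets M"
    and \<nu>: "prob_space \<nu>" "sets \<nu> = sets M" and \<rho>: "prob_space \<rho>" "sets \<rho> = sets M"
    and mass: "ennreal (1 - e) \<le> partial_potential A K (\<lambda>_. 1)" and B: "B \<in> sets M"
  shows "\<bar>measure \<nu> B - measure \<rho> B\<bar> \<le> e"
proof -
  let ?C = "space M - B"
  let ?p = "\<lambda>B. partial_potential A K (indicator B)"
  have le: "?p X \<le> ennreal (measure \<mu> X)"
    if "dominates A \<mu>" "prob_space \<mu>" "sets \<mu> = sets M" "X \<in> sets M" for \<mu> X
    using dominates_partial_potential[OF that(1) A, of "indicator X" K] that
    by (simp add: finite_measure.emeasure_eq_measure prob_space.finite_measure)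
  have compl: "measure \<mu> ?C = 1 - measure \<mu> B" if "prob_space \<mu>" "sets \<mu> = sets M" for \<mu>
    using prob_space.prob_compl[OF that(1), of B] that(2) B sets_eq_imp_space_eq[OF that(2)] by simp
  have B': "?C \<in> sets M" using B by auto
  have sp: "space \<phi> = space M" using sets_\<phi> by (rule sets_eq_imp_space_eq)
  have "(\<integral>\<^sup>+x. (killed A ^^ k) (\<lambda>_. 1) x \<partial>\<phi>) = (\<integral>\<^sup>+x. (killed A ^^ k) (indicator B) x \<partial>\<phi>) +
      (\<integral>\<^sup>+x. (killed A ^^ k) (indicator ?C) x \<partial>\<phi>)" for k
  proof -
    note [measurable_cong] = sets_\<phi>
    note [measurable] = B A killed_funpow_measurable[OF A]
    have eq: "(killed A ^^ k) (\<lambda>_. 1) x = (killed A ^^ k) (\<lambda>x. indicator B x + indicator ?C x) x"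
      if "x \<in> space M" for x
      using that
    proof (induction k arbitrary: x)
      case (Suc k)
      then show ?case
        unfolding killed_funpow_Suc
        by (intro arg_cong[where f="(*) (ennreal (1 - l))"] nn_integral_cong) (simp add: Qx)
    qed (auto simp: indicator_def)
    have "(\<integral>\<^sup>+x. (killed A ^^ k) (\<lambda>_. 1) x \<partial>\<phi>) =
        (\<integral>\<^sup>+x. (killed A ^^ k) (indicator B) x + (killed A ^^ k) (indicator ?C) x \<partial>\<phi>)"
      using B B' by (intro nn_integral_cong) (simp add: sp eq killed_funpow_add[OF A])
    then show ?thesis by (simp add: nn_integral_add)
  qed
  then have sum: "partial_potential A K (\<lambda>_. 1) = ?p B + ?p ?C"
    by (simp add: partial_potential_def distrib_left sum.distrib)
  \<comment> \<open>Finiteness of both masses permits passing to reals, where the final estimate is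
    linear arithmetic.\<close>
  have "?p X < top" if "X \<in> sets M" for X
    using le[OF dom(1) \<nu> that] by (simp add: le_less_trans)
  then obtain b c where b: "?p B = ennreal b" "0 \<le> b" and c: "?p ?C = ennreal c" "0 \<le> c"
    using B B' by (metis less_top_ennreal)
  have "1 - e \<le> b + c" using mass b c by (simp add: sum flip: ennreal_plus)
  moreover have "b \<le> measure \<nu> B" "b \<le> measure \<rho> B" "c \<le> measure \<nu> ?C" "c \<le> measure \<rho> ?C"
    using le[OF dom(1) \<nu> B] le[OF dom(1) \<nu> B'] le[OF dom(2) \<rho> B] le[OF dom(2) \<rho> B'] b c
    by auto
  ultimately show ?thesis using compl[OF \<nu>] compl[OF \<rho>] by linarith
qed

text \<open>The order of choices matters: first \<open>K\<close>, making the limiting defect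
  \<open>(1 - l)^K\<close> smaller than \<open>e\<close>, then \<open>n\<close>, large enough for
  the mass to be near its limit. The resulting bound is uniform in \<open>B\<close>.\<close>

lemma eventually_dominates_close:
  assumes A: "\<And>n. A n \<in> sets M" and ex: "\<And>x. x \<in> space M \<Longrightarrow> \<forall>\<^sub>F n in sequentially. x \<in> A n"
    and \<nu>: "\<forall>\<^sub>F n in sequentially. dominates (A n) (\<nu> n) \<and> prob_space (\<nu> n) \<and> sets (\<nu> n) = sets M"
    and \<rho>: "\<And>n. dominates (A n) \<rho>" "prob_space \<rho>" "sets \<rho> = sets M"
    and e: "0 < e"
  shows "\<forall>\<^sub>F n in sequentially. \<forall>B\<in>sets M. \<bar>measure (\<nu> n) B - measure \<rho> B\<bar> \<le> e"
proof -
  \<comment> \<open>The minimum with 1 keeps the limit \<open>1 - (1 - l)^K\<close> positive, so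
    that the strict inequality below also holds for \<open>e \<ge> 1\<close>, when
    \<open>ennreal (1 - e)\<close> is 0.\<close>
  obtain K where K: "(1 - l) ^ K < min e 1"
    using real_arch_pow_inv[of "min e 1" "1 - l"] l e by auto
  have "\<forall>\<^sub>F n in sequentially. ennreal (1 - e) < partial_potential (A n) K (\<lambda>_. 1)"
    using K l
    by (intro order_tendstoD(1)[OF partial_potential_one_tendsto[OF A ex]] ennreal_lessI) auto
  with \<nu> show ?thesis
  proof eventually_elim
    case (elim n)
    then show ?case
      using dominates_close[OF _ \<rho>(1) A _ _ \<rho>(2,3), of n "\<nu> n" e K] by auto
  qed
qed

section \<open>Existence of a stationary distribution\<close>

text \<open>The law of the chain driven by \<open>Q\<close> from \<open>\<phi>\<close> after a geometric number of steps, the time elapsed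
  since the last regeneration.\<close>

definition regenerated :: "'a measure" where
  "regenerated = measure_pmf (geometric_pmf l) \<bind> (\<lambda>k. ((\<lambda>\<mu>. \<mu> \<bind> Q) ^^ k) \<phi>)"

text \<open>First-step analysis: the geometric time is 0 with probability \<open>l\<close>, and
  otherwise one more than a time with the same law.\<close>

lemma nn_integral_geometric_pmf_unfold:
  "(\<integral>\<^sup>+k. f k \<partial>geometric_pmf l) = ennreal l * f 0 + ennreal (1 - l) * (\<integral>\<^sup>+k. f (Suc k) \<partial>geometric_pmf l)"
  for f :: "nat \<Rightarrow> ennreal"
  using l
  by (subst geometric_bind_pmf_unfold) (auto simp: ac_simps)

text \<open>A step of \<open>P\<close> restarts from \<open>\<phi>\<close> with probability
  \<open>l\<close> and otherwise makes a \<open>Q\<close>-step, which raises the elapsed time by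
  one. The geometric law of that time is invariant under this move.\<close>

lemma stationary_regenerated:
  assumes P: "P \<in> measurable M (prob_algebra M)"
    and split: "\<And>x B. x \<in> space M \<Longrightarrow> B \<in> sets M \<Longrightarrow>
      emeasure (P x) B = ennreal l * emeasure \<phi> B + ennreal (1 - l) * emeasure (Q x) B"
  shows "stationary_distribution M P regenerated"
proof -
  let ?m = "\<lambda>k. ((\<lambda>\<mu>. \<mu> \<bind> Q) ^^ k) \<phi>"
  have m: "?m k \<in> space (prob_algebra M)" for k
  proof (induction k)
    case 0
    then show ?case using prob_\<phi> sets_\<phi> by (simp add: space_prob_algebra)
  next
    case (Suc k)
    then show ?case
      using prob_space_bind'[OF Suc Q] sets_bind'[OF Suc Q] by (simp add: space_prob_algebra)
  qed
  have mp: "?m \<in> measurable (measure_pmf (geometric_pmf l)) (prob_algebra M)"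
    using m by auto
  note mm = measurable_prob_algebraD[OF mp]
  have gp: "measure_pmf (geometric_pmf l) \<in> space (prob_algebra (count_space UNIV))"
    by (simp add: space_prob_algebra measure_pmf.prob_space_axioms)
  have mp': "?m \<in> measurable (count_space UNIV) (prob_algebra M)" using m by auto
  have pr: "prob_space regenerated" unfolding regenerated_def
    by (rule prob_space_bind'[OF gp mp'])
  have st: "sets regenerated = sets M" unfolding regenerated_def
    by (rule sets_bind'[OF gp mp'])
  note [measurable_cong] = st
  have sp: "space regenerated = space M" using st by (rule sets_eq_imp_space_eq)
  have "emeasure regenerated B = (\<integral>\<^sup>+x. emeasure (P x) B \<partial>regenerated)" if B: "B \<in> sets M" for B
  proof -
    have [measurable]: "(\<lambda>x. emeasure (Q x) B) \<in> borel_measurable M"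
      by (rule measurable_emeasure_kernel[OF Q_subprob B])
    interpret prob_space regenerated by (rule pr)
    have step: "(\<integral>\<^sup>+x. emeasure (Q x) B \<partial>?m k) = emeasure (?m (Suc k)) B" for k
    proof -
      have s: "sets (?m k) = sets M" and p: "prob_space (?m k)"
        using m[of k] by (auto simp: space_prob_algebra)
      note [measurable_cong] = s
      have "Q \<in> measurable (?m k) (subprob_algebra M)" using Q_subprob by measurable
      then show ?thesis
        using emeasure_bind[OF prob_space.not_empty[OF p] _ B] by simp
    qed
    have "(\<integral>\<^sup>+x. emeasure (P x) B \<partial>regenerated) =
        (\<integral>\<^sup>+x. ennreal l * emeasure \<phi> B + ennreal (1 - l) * emeasure (Q x) B \<partial>regenerated)"
      by (intro nn_integral_cong) (simp add: sp split B)
    also have "\<dots> = ennreal l * emeasure \<phi> B + ennreal (1 - l) * (\<integral>\<^sup>+x. emeasure (Q x) B \<partial>regenerated)"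
      by (simp add: nn_integral_add nn_integral_cmult emeasure_space_1)
    also have "(\<integral>\<^sup>+x. emeasure (Q x) B \<partial>regenerated) =
        (\<integral>\<^sup>+k. (\<integral>\<^sup>+x. emeasure (Q x) B \<partial>?m k) \<partial>geometric_pmf l)"
      unfolding regenerated_def by (rule nn_integral_bind[OF _ mm]) measurable
    also have "\<dots> = (\<integral>\<^sup>+k. emeasure (?m (Suc k)) B \<partial>geometric_pmf l)"
      by (simp only: step)
    \<comment> \<open>The restart term is the value at time 0, and the \<open>Q\<close>-step has
      shifted the index, so this is the first-step identity read backwards.\<close>
    also have "ennreal l * emeasure \<phi> B + ennreal (1 - l) * \<dots> = (\<integral>\<^sup>+k. emeasure (?m k) B \<partial>geometric_pmf l)"
      using nn_integral_geometric_pmf_unfold[of "\<lambda>k. emeasure (?m k) B"] by simp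
    also have "\<dots> = emeasure regenerated B"
      unfolding regenerated_def by (rule emeasure_bind[OF _ mm B, symmetric]) simp
    finally show ?thesis by simp
  qed
  with pr st show ?thesis by (simp add: stationary_distribution_def)
qed

section \<open>Stationary laws dominate; uniqueness\<close>

text \<open>Stationarity gives \<open>\<pi> = l \<phi> + (1 - l) \<pi> Q\<close>, and killing
  outside \<open>A\<close> only removes mass from the second term.\<close>

lemma dominates_stationary:
  assumes P: "P \<in> measurable M (prob_algebra M)"
    and split: "\<And>x B. x \<in> space M \<Longrightarrow> B \<in> sets M \<Longrightarrow>
      emeasure (P x) B = ennreal l * emeasure \<phi> B + ennreal (1 - l) * emeasure (Q x) B"
    and \<pi>: "stationary_distribution M P \<pi>" and A: "A \<in> sets M"
  shows "dominates A \<pi>"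
  unfolding dominates_def
proof
  fix f :: "'a \<Rightarrow> ennreal" assume f: "f \<in> borel_measurable M"
  have s: "sets \<pi> = sets M" using \<pi> by (simp add: stationary_distribution_def)
  interpret prob_space \<pi> using \<pi> by (simp add: stationary_distribution_def)
  have sp: "space \<pi> = space M" using s by (rule sets_eq_imp_space_eq)
  note [measurable_cong] = s
  note [measurable] = f killed_measurable[OF A f]
  have "ennreal l * (\<integral>\<^sup>+x. f x \<partial>\<phi>) + (\<integral>\<^sup>+x. killed A f x \<partial>\<pi>)
      = (\<integral>\<^sup>+x. ennreal l * (\<integral>\<^sup>+x. f x \<partial>\<phi>) + killed A f x \<partial>\<pi>)"
    by (simp add: nn_integral_add emeasure_space_1)
  also have "\<dots> \<le> (\<integral>\<^sup>+x. \<integral>\<^sup>+y. f y \<partial>P x \<partial>\<pi>)"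
  proof (rule nn_integral_mono)
    fix x assume "x \<in> space \<pi>"
    then have x: "x \<in> space M" by (simp add: sp)
    have "sets (P x) = sets M" using measurable_space[OF P x] by (simp add: space_prob_algebra)
    from nn_integral_mixture[OF this sets_\<phi> Qx(2)[OF x] split[OF x] f]
    have "(\<integral>\<^sup>+y. f y \<partial>P x) = ennreal l * (\<integral>\<^sup>+x. f x \<partial>\<phi>) + ennreal (1 - l) * (\<integral>\<^sup>+y. f y \<partial>Q x)" .
    moreover have "killed A f x \<le> ennreal (1 - l) * (\<integral>\<^sup>+y. f y \<partial>Q x)"
      unfolding killed_def by (intro mult_left_mono nn_integral_mono) (auto simp: indicator_def)
    ultimately show "ennreal l * (\<integral>\<^sup>+x. f x \<partial>\<phi>) + killed A f x \<le> (\<integral>\<^sup>+y. f y \<partial>P x)"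
      by (simp add: add_left_mono)
  qed
  also have "\<dots> = (\<integral>\<^sup>+x. f x \<partial>\<pi>)"
    by (rule stationary_nn_integral[OF \<pi> P f, symmetric])
  finally show "ennreal l * (\<integral>\<^sup>+x. f x \<partial>\<phi>) + (\<integral>\<^sup>+x. killed A f x \<partial>\<pi>) \<le> (\<integral>\<^sup>+x. f x \<partial>\<pi>)" .
qed

lemma stationary_unique:
  assumes P: "P \<in> measurable M (prob_algebra M)"
    and split: "\<And>x B. x \<in> space M \<Longrightarrow> B \<in> sets M \<Longrightarrow>
      emeasure (P x) B = ennreal l * emeasure \<phi> B + ennreal (1 - l) * emeasure (Q x) B"
    and \<nu>: "stationary_distribution M P \<nu>" and \<rho>: "stationary_distribution M P \<rho>"
  shows "\<nu> = \<rho>"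
proof -
  have p: "prob_space \<nu>" "prob_space \<rho>" and s: "sets \<nu> = sets M" "sets \<rho> = sets M"
    using \<nu> \<rho> by (auto simp: stationary_distribution_def)
  \<comment> \<open>The whole space as the set \<open>A\<close> means no killing, so the closeness
    estimate applies to a constant sequence.\<close>
  have dom: "dominates (space M) \<nu>" "dominates (space M) \<rho>"
    by (rule dominates_stationary[OF P split], assumption+, (rule \<nu> \<rho>), simp)+
  have "measure \<nu> B = measure \<rho> B" if B: "B \<in> sets M" for B
  proof -
    have "\<bar>measure \<nu> B - measure \<rho> B\<bar> \<le> 0 + e" if "0 < e" for e
      using eventually_dominates_close[of "\<lambda>_. space M" "\<lambda>_. \<nu>" \<rho> e] dom p s that B by simp
    then have "\<bar>measure \<nu> B - measure \<rho> B\<bar> \<le> 0"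
      by (rule field_le_epsilon)
    then show ?thesis by simp
  qed
  then show ?thesis
    using p s by (intro measure_eqI)
      (auto simp: finite_measure.emeasure_eq_measure prob_space.finite_measure)
qed

section \<open>Stationary laws of augmented chains\<close>

text \<open>Restricting \<open>P x\<close> to \<open>A\<close> leaves exactly
  \<open>l \<phi>\<close> plus the killed kernel, because \<open>\<phi>\<close> lives on
  \<open>A\<close> and loses nothing. The added kernel only increases this, so stationarity under
  \<open>P'\<close> yields the inequality.\<close>

lemma dominates_augmentation:
  assumes P: "P \<in> measurable M (prob_algebra M)"
    and split: "\<And>x B. x \<in> space M \<Longrightarrow> B \<in> sets M \<Longrightarrow>
      emeasure (P x) B = ennreal l * emeasure \<phi> B + ennreal (1 - l) * emeasure (Q x) B"
    and A: "A \<in> sets M" and \<phi>A: "measure \<phi> A = 1"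
    and aug: "general_augmentation M A P P'"
    and \<nu>: "stationary_distribution (restrict_space M A) P' \<nu>"
  shows "dominates A (extend_measure_to M \<nu>)"
    and "prob_space (extend_measure_to M \<nu>)" and "sets (extend_measure_to M \<nu>) = sets M"
proof -
  let ?N = "restrict_space M A"
  have s: "sets \<nu> = sets ?N" using \<nu> by (simp add: stationary_distribution_def)
  interpret prob_space \<nu> using \<nu> by (simp add: stationary_distribution_def)
  note [measurable_cong] = s
  have spN: "space ?N = A" using A sets.sets_into_space by (auto simp: space_restrict_space)
  then have sp: "space \<nu> = A" using sets_eq_imp_space_eq[OF s] by simp
  have AM: "A \<subseteq> space M" using A by (rule sets.sets_into_space)
  have id: "(\<lambda>x. x) \<in> measurable ?N M" by (intro measurable_restrict_space1) simp
  then have idn[measurable]: "(\<lambda>x. x) \<in> measurable \<nu> M" by measurable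
  show "prob_space (extend_measure_to M \<nu>)" unfolding extend_measure_to_def
    by (rule prob_space_distr[OF idn])
  show "sets (extend_measure_to M \<nu>) = sets M" by (simp add: extend_measure_to_def)
  have P': "P' \<in> measurable ?N (prob_algebra ?N)"
    using aug by (simp add: general_augmentation_def markov_kernel_def)
  obtain R where R: "R \<in> measurable ?N (subprob_algebra ?N)"
    and PR: "\<And>x B. x \<in> A \<Longrightarrow> B \<in> sets ?N \<Longrightarrow> emeasure (P' x) B = emeasure (P x) B + emeasure (R x) B"
    using aug unfolding general_augmentation_def by blast
  have ext: "(\<integral>\<^sup>+x. f x \<partial>extend_measure_to M \<nu>) = (\<integral>\<^sup>+x. f x \<partial>\<nu>)" if "f \<in> borel_measurable M" for f
    unfolding extend_measure_to_def using that by (simp add: nn_integral_distr[OF idn])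
  show "dominates A (extend_measure_to M \<nu>)"
    unfolding dominates_def
  proof
    fix f :: "'a \<Rightarrow> ennreal" assume f: "f \<in> borel_measurable M"
    have fN: "f \<in> borel_measurable ?N" using f by (rule measurable_restrict_space1)
    have kN: "killed A f \<in> borel_measurable ?N"
      using killed_measurable[OF A f] by (rule measurable_restrict_space1)
    note [measurable] = f kN A
    have fA: "(\<lambda>x. f x * indicator A x) \<in> borel_measurable M"
      by (intro borel_measurable_times_ennreal f borel_measurable_indicator A)
    have "AE x in \<phi>. x \<in> A"
      using prob_space.AE_prob_1[OF prob_\<phi>] \<phi>A by simp
    then have \<phi>f: "(\<integral>\<^sup>+x. f x * indicator A x \<partial>\<phi>) = (\<integral>\<^sup>+x. f x \<partial>\<phi>)"
      by (intro nn_integral_cong_AE) auto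
    have "ennreal l * (\<integral>\<^sup>+x. f x \<partial>\<phi>) + (\<integral>\<^sup>+x. killed A f x \<partial>\<nu>)
        = (\<integral>\<^sup>+x. ennreal l * (\<integral>\<^sup>+x. f x \<partial>\<phi>) + killed A f x \<partial>\<nu>)"
      by (simp add: nn_integral_add emeasure_space_1)
    also have "\<dots> \<le> (\<integral>\<^sup>+x. \<integral>\<^sup>+y. f y \<partial>P' x \<partial>\<nu>)"
    proof (rule nn_integral_mono)
      fix x assume "x \<in> space \<nu>"
      then have x: "x \<in> A" "x \<in> space M" using sp AM by auto
      have sP: "sets (P x) = sets M"
        using measurable_space[OF P x(2)] by (simp add: space_prob_algebra)
      have sP': "sets (P' x) = sets ?N"
        using measurable_space[OF P', of x] x spN by (simp add: space_prob_algebra)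
      have sR: "sets (R x) = sets ?N"
        using measurable_space[OF R, of x] x spN by (simp add: space_subprob_algebra)
      have AP: "A \<inter> space (P x) \<in> sets (P x)" using A sP by auto
      \<comment> \<open>The splitting of \<open>P x\<close> is integrated against \<open>f\<close>
        cut off outside \<open>A\<close>: the cut-off is invisible to \<open>\<phi>\<close> and is
        the killing for \<open>Q x\<close>.\<close>
      have "ennreal l * (\<integral>\<^sup>+x. f x \<partial>\<phi>) + killed A f x = (\<integral>\<^sup>+y. f y * indicator A y \<partial>P x)"
        unfolding killed_def \<phi>f[symmetric]
        by (rule nn_integral_mixture[OF sP sets_\<phi> Qx(2)[OF x(2)] split[OF x(2)] fA, symmetric])
      also have "\<dots> = (\<integral>\<^sup>+y. f y \<partial>restrict_space (P x) A)"
        by (rule nn_integral_restrict_space[OF AP, symmetric])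
      \<comment> \<open>The coefficients 1 put the sum into the shape of
        \<open>nn_integral_mixture\<close>.\<close>
      also have "\<dots> \<le> 1 * (\<integral>\<^sup>+y. f y \<partial>restrict_space (P x) A) + 1 * (\<integral>\<^sup>+y. f y \<partial>R x)"
        by simp
      also have "\<dots> = (\<integral>\<^sup>+y. f y \<partial>P' x)"
      proof (rule nn_integral_mixture[OF sP' _ sR _ fN, symmetric])
        show "sets (restrict_space (P x) A) = sets ?N"
          using sP by (simp add: sets_restrict_space)
        fix B assume B: "B \<in> sets ?N"
        then have "B \<subseteq> A" using A by (simp add: sets_restrict_space_iff)
        then show "emeasure (P' x) B = 1 * emeasure (restrict_space (P x) A) B + 1 * emeasure (R x) B"
          using PR[OF x(1) B] AP by (simp add: emeasure_restrict_space)
      qed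
      finally show "ennreal l * (\<integral>\<^sup>+x. f x \<partial>\<phi>) + killed A f x \<le> (\<integral>\<^sup>+y. f y \<partial>P' x)" .
    qed
    also have "\<dots> = (\<integral>\<^sup>+x. f x \<partial>\<nu>)"
      by (rule stationary_nn_integral[OF \<nu> P' fN, symmetric])
    finally show "ennreal l * (\<integral>\<^sup>+x. f x \<partial>\<phi>) + (\<integral>\<^sup>+x. killed A f x \<partial>extend_measure_to M \<nu>)
        \<le> (\<integral>\<^sup>+x. f x \<partial>extend_measure_to M \<nu>)"
      by (simp add: ext killed_measurable[OF A f])
  qed
qed

end

section \<open>Recurrence of augmentations and convergence\<close>

lemma split_chainE:
  assumes P: "markov_kernel M P" and l: "0 < l" and \<phi>: "prob_space \<phi>" "sets \<phi> = sets M"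
    and minor: "minorized M P l \<phi>"
  obtains l' Q where "split_chain M l' \<phi> Q"
    and "\<And>x B. x \<in> space M \<Longrightarrow> B \<in> sets M \<Longrightarrow>
      emeasure (P x) B = ennreal l' * emeasure \<phi> B + ennreal (1 - l') * emeasure (Q x) B"
proof -
  \<comment> \<open>Any constant below 1 would do as a cap; for \<open>l = 1\<close> no residual
    mass would be left to normalise.\<close>
  define l' where "l' = min l (1/2)"
  have l': "0 < l'" "l' < 1" using l by (auto simp: l'_def)
  have "minorized M P l' \<phi>"
    unfolding minorized_def
  proof (intro ballI)
    fix x B assume "x \<in> space M" "B \<in> sets M"
    then have "l * measure \<phi> B \<le> measure (P x) B" using minor by (simp add: minorized_def)
    moreover have "l' * measure \<phi> B \<le> l * measure \<phi> B" by (intro mult_right_mono) (auto simp: l'_def)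
    ultimately show "l' * measure \<phi> B \<le> measure (P x) B" by simp
  qed
  from residual_kernel[OF P[unfolded markov_kernel_def] \<phi> l' this] obtain Q
    where Q: "Q \<in> measurable M (prob_algebra M)"
      "\<And>x B. x \<in> space M \<Longrightarrow> B \<in> sets M \<Longrightarrow>
        emeasure (P x) B = ennreal l' * emeasure \<phi> B + ennreal (1 - l') * emeasure (Q x) B" by blast
  show ?thesis
    by (rule that[OF _ Q(2)]) (auto simp: split_chain_def l' \<phi> Q(1))
qed

text \<open>Stated for an arbitrary space so that it applies to each augmented chain on
  \<open>A n\<close>, which gets a splitting of its own.\<close>

lemma ex1_stationary_distribution:
  assumes P: "markov_kernel M P" and rec: "strongly_uniformly_recurrent M P"
  shows "\<exists>!\<nu>. stationary_distribution M P \<nu>"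
proof -
  obtain l \<phi> where "l > 0" "prob_space \<phi>" "sets \<phi> = sets M" "minorized M P l \<phi>"
    using rec by (auto simp: strongly_uniformly_recurrent_def)
  from split_chainE[OF P this] obtain l' Q where Q: "split_chain M l' \<phi> Q"
    and split: "\<And>x B. x \<in> space M \<Longrightarrow> B \<in> sets M \<Longrightarrow>
      emeasure (P x) B = ennreal l' * emeasure \<phi> B + ennreal (1 - l') * emeasure (Q x) B" by blast
  have P': "P \<in> measurable M (prob_algebra M)" using P by (simp add: markov_kernel_def)
  show ?thesis
    using split_chain.stationary_regenerated[OF Q P' split] split_chain.stationary_unique[OF Q P' split]
    by blast
qed

text \<open>The same constant \<open>l\<close> works with \<open>\<phi>\<close> restricted to
  \<open>A\<close>, still a probability, since the augmented kernel is at least \<open>P\<close> on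
  subsets of \<open>A\<close>.\<close>

lemma augmentation_strongly_uniformly_recurrent:
  assumes P: "markov_kernel M P" and A: "A \<in> sets M" and aug: "general_augmentation M A P P'"
    and l: "l > 0" and \<phi>: "prob_space \<phi>" "sets \<phi> = sets M" "measure \<phi> A = 1"
    and minor: "minorized M P l \<phi>"
  shows "strongly_uniformly_recurrent (restrict_space M A) P'"
proof -
  interpret prob_space \<phi> by (rule \<phi>(1))
  have A\<phi>: "A \<inter> space \<phi> \<in> sets \<phi>" using A \<phi>(2) by auto
  have m: "measure (restrict_space \<phi> A) B = measure \<phi> B" if "B \<subseteq> A" for B
    using A\<phi> that by (rule measure_restrict_space)
  have AM: "A \<subseteq> space M" using A by (rule sets.sets_into_space)
  have "prob_space (restrict_space \<phi> A)"
    using A A\<phi> \<phi> AM sets_eq_imp_space_eq[OF \<phi>(2)]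
    by (intro prob_space_restrict_space) (auto simp: emeasure_eq_measure)
  moreover have "sets (restrict_space \<phi> A) = sets (restrict_space M A)"
    using \<phi>(2) by (simp add: sets_restrict_space)
  moreover have "minorized (restrict_space M A) P' l (restrict_space \<phi> A)"
    unfolding minorized_def
  proof (intro ballI)
    fix x B assume "x \<in> space (restrict_space M A)" "B \<in> sets (restrict_space M A)"
    then have x: "x \<in> A" "x \<in> space M" and B: "B \<in> sets M" "B \<subseteq> A"
      using A AM by (auto simp: space_restrict_space sets_restrict_space_iff)
    have "l * measure \<phi> B \<le> measure (P x) B" using minor x B by (simp add: minorized_def)
    also have "\<dots> \<le> measure (P' x) B"
      using aug x B by (simp add: general_augmentation_iff[OF P A])
    finally show "l * measure (restrict_space \<phi> A) B \<le> measure (P' x) B" by (simp add: m B)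
  qed
  ultimately show ?thesis using l unfolding strongly_uniformly_recurrent_def by blast
qed

theorem theorem6:
  fixes M :: "'a measure" and P :: "'a \<Rightarrow> 'a measure" and A :: "nat \<Rightarrow> 'a set"
    and l :: real and \<phi> \<pi> :: "'a measure" and P' :: "nat \<Rightarrow> 'a \<Rightarrow> 'a measure"
  assumes "markov_kernel M P"
    and "\<And>n. n \<ge> 1 \<Longrightarrow> A n \<in> sets M"
    and "A 1 \<noteq> {}"
    and "\<And>n. n \<ge> 1 \<Longrightarrow> A n \<subseteq> A (Suc n)"
    and "(\<Union>n\<in>{1..}. A n) = space M"
    and "l > 0" and "prob_space \<phi>" and "sets \<phi> = sets M" and "minorized M P l \<phi>"
    and "measure \<phi> (A 1) = 1"
    and "stationary_distribution M P \<pi>"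
    and "\<And>\<nu>. stationary_distribution M P \<nu> \<Longrightarrow> \<nu> = \<pi>"
    and "\<And>n. n \<ge> 1 \<Longrightarrow> general_augmentation M (A n) P (P' n)"
  shows "(\<forall>n\<ge>1. strongly_uniformly_recurrent (restrict_space M (A n)) (P' n)
              \<and> (\<exists>!\<nu>. stationary_distribution (restrict_space M (A n)) (P' n) \<nu>))
       \<and> (\<forall>\<pi>'. (\<forall>n\<ge>1. stationary_distribution (restrict_space M (A n)) (P' n) (\<pi>' n)) \<longrightarrow>
            (\<lambda>n. SUP B\<in>sets M. \<bar>measure (extend_measure_to M (\<pi>' n)) B - measure \<pi> B\<bar>)
              \<longlonglongrightarrow> 0)"
proof -
  note P = assms(1) and l = assms(6) and \<phi> = assms(7,8) and minor = assms(9) and \<pi> = assms(11)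
  note aug = assms(13)
  have P': "P \<in> measurable M (prob_algebra M)" using P by (simp add: markov_kernel_def)
  have mono: "A m \<subseteq> A n" if "1 \<le> m" "m \<le> n" for m n
    using that(2)
  proof (induction n rule: dec_induct)
    case (step k)
    then show ?case using assms(4)[of k] that(1) by auto
  qed simp
  have \<phi>A: "measure \<phi> (A n) = 1" if "n \<ge> 1" for n
  proof -
    interpret prob_space \<phi> by (rule \<phi>(1))
    have "measure \<phi> (A 1) \<le> measure \<phi> (A n)"
      using assms(2) that mono \<phi>(2) by (intro finite_measure_mono) auto
    then show ?thesis using assms(10) prob_le_1 by (intro antisym) auto
  qed
  have rec: "strongly_uniformly_recurrent (restrict_space M (A n)) (P' n)" if "n \<ge> 1" for n
    by (rule augmentation_strongly_uniformly_recurrent[OF P assms(2) aug l \<phi> \<phi>A minor]) (rule that)+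
  have ex1: "\<exists>!\<nu>. stationary_distribution (restrict_space M (A n)) (P' n) \<nu>" if "n \<ge> 1" for n
    using aug[OF that] rec[OF that]
    by (intro ex1_stationary_distribution) (auto simp: general_augmentation_def)
  \<comment> \<open>One splitting of \<open>P\<close> serves all \<open>n\<close>; only the killing
    set varies.\<close>
  obtain l' Q where Q: "split_chain M l' \<phi> Q"
    and split: "\<And>x B. x \<in> space M \<Longrightarrow> B \<in> sets M \<Longrightarrow>
      emeasure (P x) B = ennreal l' * emeasure \<phi> B + ennreal (1 - l') * emeasure (Q x) B"
    using split_chainE[OF P l \<phi> minor] by blast
  interpret split_chain M l' \<phi> Q by (rule Q)
  have "(\<lambda>n. SUP B\<in>sets M. \<bar>measure (extend_measure_to M (\<pi>' n)) B - measure \<pi> B\<bar>) \<longlonglongrightarrow> 0"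
    if \<pi>': "\<forall>n\<ge>1. stationary_distribution (restrict_space M (A n)) (P' n) (\<pi>' n)" for \<pi>'
  proof (rule tendstoI)
    fix e :: real assume e: "0 < e"
    \<comment> \<open>The hypotheses say nothing about \<open>A 0\<close>; the empty set makes every
      member of the sequence measurable.\<close>
    define A' where "A' n = (if n = 0 then {} else A n)" for n
    have A': "A' n \<in> sets M" for n using assms(2)[of n] by (simp add: A'_def)
    have ex: "\<forall>\<^sub>F n in sequentially. x \<in> A' n" if x: "x \<in> space M" for x
    proof -
      obtain m where m: "1 \<le> m" "x \<in> A m" using x assms(5) by blast
      show ?thesis
        using eventually_ge_at_top[of m] by eventually_elim (use m mono in \<open>auto simp: A'_def\<close>)
    qed
    \<comment> \<open>Half of \<open>e\<close> leaves room for the strict inequality after taking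
      the supremum.\<close>
    have "\<forall>\<^sub>F n in sequentially. \<forall>B\<in>sets M.
        \<bar>measure (extend_measure_to M (\<pi>' n)) B - measure \<pi> B\<bar> \<le> e / 2"
    proof (rule eventually_dominates_close[OF A' ex])
      show "\<forall>\<^sub>F n in sequentially. dominates (A' n) (extend_measure_to M (\<pi>' n)) \<and>
          prob_space (extend_measure_to M (\<pi>' n)) \<and> sets (extend_measure_to M (\<pi>' n)) = sets M"
        using eventually_ge_at_top[of 1]
      proof eventually_elim
        case (elim n)
        have st: "stationary_distribution (restrict_space M (A n)) (P' n) (\<pi>' n)"
          using \<pi>' elim by simp
        have "A' n = A n" using elim by (simp add: A'_def)
        then show ?case
          using dominates_augmentation[OF P' split assms(2)[OF elim] \<phi>A[OF elim] aug[OF elim] st]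
          by presburger
      qed
      show "dominates (A' n) \<pi>" for n by (rule dominates_stationary[OF P' split \<pi> A'])
    qed (use \<pi> e in \<open>auto simp: stationary_distribution_def\<close>)
    then show "\<forall>\<^sub>F n in sequentially.
        dist (SUP B\<in>sets M. \<bar>measure (extend_measure_to M (\<pi>' n)) B - measure \<pi> B\<bar>) 0 < e"
    proof eventually_elim
      case (elim n)
      let ?d = "\<lambda>B. \<bar>measure (extend_measure_to M (\<pi>' n)) B - measure \<pi> B\<bar>"
      have "(SUP B\<in>sets M. ?d B) \<le> e / 2" using elim by (intro cSUP_least) auto
      \<comment> \<open>The empty set contributes 0, so the supremum is non-negative and equals its
        distance to 0.\<close>
      moreover have "?d {} \<le> (SUP B\<in>sets M. ?d B)"
        using elim by (intro cSUP_upper bdd_aboveI2[where M="e / 2"]) auto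
      ultimately show ?case using e by (simp add: dist_real_def)
    qed
  qed
  with rec ex1 show ?thesis by blast
qed

end
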